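(* Let $r\ge3$ be a natural number and let $(b_n)_{n\ge1}$ be a sequence of complex numbers with $(b_n)\in GM(\beta^{\ast},r)$. If $n|b_n|\to0$ as $n\to\infty$ and $$\sum_{n=1}^{\infty}\sum_{k=1}^{[r/2]}\left|b_{r\cdot n+k}-b_{r\cdot n+r-k}\right|<\infty,$$ then the series $$\sum_{n=1}^{\infty}b_n\sin nx$$ converges uniformly in $x\in\mathbb{R}$.
   Context: $\mathbb{N}=\{1,2,3,\dots\}$ and $[x]$ denotes the integer part of $x$. Sequences $a=(a_n)_{n\ge 1}$ are sequences of complex numbers indexed by the positive integers. For $r\in\mathbb{N}$, the class $GM(\beta^{\ast},r)$ is the set of all complex sequences $a=(a_n)$ for which there exist a real number $c>1$ and a constant $K(a)$ (both may depend on the sequence $a$, but not on $m$) such that for all $m\in\mathbb{N}$ $$\sum_{n=m}^{2m-1}|a_n-a_{n+r}|\le K(a)\,\beta^{\ast}_m,\qquad \beta^{\ast}_m=\sum_{k=m}^{m+r-1}|a_k|+\sum_{k=[m/c]}^{[cm]}\frac{|a_k|}{k}.$$ In the last sum only indices $k\ge 1$ are taken (i.e. if $[m/c]=0$ the sum starts at $k=1$). *)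

theory Defs
  imports "HOL-Analysis.Analysis"
begin

text \<open>
  Sequences indexed by the positive integers are functions on \<^typ>\<open>nat\<close> whose value at 0
  is never used.
\<close>

text \<open>
  The lower bound of the second sum is \<open>max 1 [m/c]\<close>, since only indices \<open>k \<ge> 1\<close> are taken.
\<close>

definition beta_star :: "nat \<Rightarrow> real \<Rightarrow> (nat \<Rightarrow> complex) \<Rightarrow> nat \<Rightarrow> real" where
  "beta_star r c a m =
     (\<Sum>k = m..m + r - 1. norm (a k)) +
     (\<Sum>k = max 1 (nat \<lfloor>real m / c\<rfloor>)..nat \<lfloor>c * real m\<rfloor>. norm (a k) / real k)"

definition GM_beta_star :: "nat \<Rightarrow> (nat \<Rightarrow> complex) set" where
  "GM_beta_star r =
     {a. \<exists>(c::real) (K::real). c > 1 \<and>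
           (\<forall>m\<ge>1. (\<Sum>n = m..2 * m - 1. norm (a n - a (n + r))) \<le> K * beta_star r c a m)}"

end

theory Submission
  imports Defs
begin

text \<open>
  Dyadic summation of the class condition together with \<open>n |b\<^sub>n| \<rightarrow> 0\<close> gives
  \<open>m \<Sum>\<^bsub>n > m\<^esub> |b\<^sub>n - b\<^bsub>n+r\<^esub>| \<rightarrow> 0\<close>. Write \<open>x = y + h\<close> with \<open>y\<close> the multiple of \<open>2\<pi>/r\<close> nearest to \<open>x\<close>.
  For \<open>n \<le> 1/|h|\<close> replace \<open>sin nx\<close> by \<open>sin ny\<close>, at cost \<open>|h| n |b\<^sub>n|\<close> per term; the sums at the
  grid points \<open>y\<close> are Cauchy uniformly in \<open>y\<close>, because \<open>sin ky\<close> changes sign under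
  \<open>k \<mapsto> r - k\<close> and the summability hypothesis applies to each block of length \<open>r\<close>. For
  \<open>n > 1/|h|\<close> sum by parts with step \<open>r\<close>: multiplying by \<open>1 - exp(irx)\<close>, whose modulus is at least
  \<open>|h|\<close>, leaves only boundary terms and the variation above.
\<close>

section \<open>Trigonometric estimates\<close>

lemma jordan_sin_ge:
  fixes t :: real
  assumes "0 \<le> t" "t \<le> pi / 2"
  shows "2 / pi * t \<le> sin t"
proof -
  have "convex_on {0..pi/2} (\<lambda>x::real. - sin x)"
  proof (rule f''_ge0_imp_convex)
    show "((\<lambda>x::real. - sin x) has_real_derivative - cos x) (at x)" for x
      by (auto intro!: derivative_eq_intros)
    show "((\<lambda>x::real. - cos x) has_real_derivative sin x) (at x)" for x
      by (auto intro!: derivative_eq_intros)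
    show "sin x \<ge> 0" if "x \<in> {0..pi/2}" for x :: real
      using that by (intro sin_ge_zero) auto
  qed auto
  \<comment> \<open>Concavity puts the graph of sine above its chord from (0, 0) to (pi/2, 1);
    \<open>2 / pi * t\<close> is the position of \<open>t\<close> along that chord.\<close>
  from convex_onD[OF this, of "2 / pi * t" 0 "pi / 2"] assms
  show ?thesis by (auto simp: field_simps)
qed

lemma norm_one_minus_cis: "norm (1 - cis \<theta>) = 2 * \<bar>sin (\<theta> / 2)\<bar>"
proof -
  have "(norm (1 - cis \<theta>))\<^sup>2 = (1 - cos \<theta>)\<^sup>2 + (sin \<theta>)\<^sup>2"
    by (simp add: cmod_power2)
  also have "\<dots> = 2 - 2 * cos \<theta>"
    using sin_cos_squared_add[of \<theta>] by (simp add: power2_eq_square algebra_simps)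
  also have "cos \<theta> = 1 - 2 * (sin (\<theta> / 2))\<^sup>2"
    using cos_double_sin[of "\<theta> / 2"] by simp
  finally have "(norm (1 - cis \<theta>))\<^sup>2 = (2 * \<bar>sin (\<theta> / 2)\<bar>)\<^sup>2"
    by (simp add: power_mult_distrib)
  then show ?thesis
    by (rule power2_eq_imp_eq) auto
qed

text \<open>Jordan's inequality at half the angle gives the constant 2/pi, which pi < 4 rounds down
  to 1/2.\<close>

lemma norm_one_minus_cis_ge:
  assumes "\<bar>\<theta>\<bar> \<le> pi"
  shows "\<bar>\<theta>\<bar> / 2 \<le> norm (1 - cis \<theta>)"
proof -
  have "\<bar>\<theta>\<bar> / 2 \<le> 2 * (2 / pi * (\<bar>\<theta>\<bar> / 2))"
    using pi_less_4 pi_gt_zero mult_right_mono[of pi 4 "\<bar>\<theta>\<bar>"] by (simp add: field_simps)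
  also have "\<dots> \<le> 2 * sin (\<bar>\<theta>\<bar> / 2)"
    using jordan_sin_ge[of "\<bar>\<theta>\<bar> / 2"] assms by simp
  also have "\<dots> \<le> 2 * \<bar>sin (\<theta> / 2)\<bar>"
    by (cases "\<theta> \<ge> 0") auto
  finally show ?thesis by (simp add: norm_one_minus_cis)
qed

lemma abs_sin_diff_le: "\<bar>sin x - sin y\<bar> \<le> \<bar>x - y :: real\<bar>"
proof -
  have "\<bar>sin x - sin y\<bar> = 2 * (\<bar>sin ((x - y) / 2)\<bar> * \<bar>cos ((x + y) / 2)\<bar>)"
    by (simp add: sin_diff_sin abs_mult)
  also have "\<dots> \<le> 2 * (\<bar>(x - y) / 2\<bar> * 1)"
    by (intro mult_left_mono mult_mono abs_sin_x_le_abs_x) auto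
  finally show ?thesis by simp
qed

section \<open>Summation by parts with step r\<close>

text \<open>Multiplication by \<open>z ^ r\<close> moves the coefficient \<open>b n\<close> to the
  power \<open>n + r\<close>. Comparing it there with \<open>b (n + r)\<close> leaves the
  differences, and the sums over \<open>{N<..M}\<close> and \<open>{N+r<..M+r}\<close> cancel on
  their overlap except for a block of length \<open>r\<close> at each end.\<close>

lemma sum_shift_by_parts:
  fixes b :: "nat \<Rightarrow> 'a :: comm_ring_1"
  assumes "N \<le> M"
  shows "(1 - z ^ r) * (\<Sum>n\<in>{N<..M}. b n * z ^ n) =
    (\<Sum>n\<in>{N<..N+r}. b n * z ^ n) - (\<Sum>n\<in>{M<..M+r}. b n * z ^ n)
    - (\<Sum>n\<in>{N<..M}. (b n - b (n + r)) * z ^ (n + r))"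
  using assms
proof (induction M rule: dec_induct)
  case base
  then show ?case by simp
next
  case (step M)
  have 1: "{N<..Suc M} = insert (Suc M) {N<..M}"
    using step.hyps by auto
  \<comment> \<open>Peeling this window of length \<open>r + 1\<close> at its right end, then at its
    left end, expresses how the boundary block slides from \<open>M\<close> to
    \<open>Suc M\<close>.\<close>
  have "(\<Sum>n\<in>{M<..Suc M + r}. f n) = (\<Sum>n\<in>{M<..M + r}. f n) + f (Suc M + r)" for f :: "nat \<Rightarrow> 'a"
  proof -
    have "{M<..Suc M + r} = insert (Suc M + r) {M<..M + r}" by auto
    then show ?thesis by (simp add: add.commute)
  qed
  moreover have "(\<Sum>n\<in>{M<..Suc M + r}. f n) = f (Suc M) + (\<Sum>n\<in>{Suc M<..Suc M + r}. f n)"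
    for f :: "nat \<Rightarrow> 'a"
  proof -
    have "{M<..Suc M + r} = insert (Suc M) {Suc M<..Suc M + r}" by auto
    then show ?thesis by simp
  qed
  ultimately have 2: "(\<Sum>n\<in>{Suc M<..Suc M + r}. f n)
      = (\<Sum>n\<in>{M<..M + r}. f n) + f (Suc M + r) - f (Suc M)" for f :: "nat \<Rightarrow> 'a"
    by (metis add_diff_cancel_left')
  show ?case
    unfolding 1 2 using step.IH by (simp add: algebra_simps power_add)
qed

lemma norm_sum_shift_le:
  fixes b :: "nat \<Rightarrow> 'a :: {real_normed_field}"
  assumes "N \<le> M" "norm z = 1"
  shows "norm (1 - z ^ r) * norm (\<Sum>n\<in>{N<..M}. b n * z ^ n) \<le>
    (\<Sum>n\<in>{N<..N+r}. norm (b n)) + (\<Sum>n\<in>{M<..M+r}. norm (b n))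
    + (\<Sum>n\<in>{N<..M}. norm (b n - b (n + r)))"
proof -
  have le: "norm (\<Sum>n\<in>A. c n * z ^ k n) \<le> (\<Sum>n\<in>A. norm (c n))"
    for A :: "nat set" and c :: "nat \<Rightarrow> 'a" and k :: "nat \<Rightarrow> nat"
    by (rule order.trans[OF norm_sum]) (simp add: norm_mult norm_power assms)
  show ?thesis
    unfolding norm_mult[symmetric] sum_shift_by_parts[OF assms(1)]
    by (intro order.trans[OF norm_triangle_ineq4] add_mono le)
qed

lemma norm_sin_sum_shift_le:
  fixes b :: "nat \<Rightarrow> complex"
  assumes "N \<le> M"
  shows "norm (1 - cis (real r * x)) * norm (\<Sum>n\<in>{N<..M}. b n * of_real (sin (real n * x))) \<le>
    (\<Sum>n\<in>{N<..N+r}. norm (b n)) + (\<Sum>n\<in>{M<..M+r}. norm (b n))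
    + (\<Sum>n\<in>{N<..M}. norm (b n - b (n + r)))" (is "?c * norm ?S \<le> ?E")
proof -
  \<comment> \<open>\<open>b\<close> is complex-valued, so the sine sum is not the imaginary part of \<open>?T x\<close>.\<close>
  let ?T = "\<lambda>x. \<Sum>n\<in>{N<..M}. b n * cis x ^ n"
  have "of_real (sin t) = (cis t - cis (- t)) / (2 * \<i>)" for t
    by (simp add: complex_eq_iff)
  then have sin_eq: "of_real (sin (real n * x)) = (cis x ^ n - cis (- x) ^ n) / (2 * \<i>)" for n
    by (simp only: Complex.DeMoivre mult_minus_right)
  have "?S = (?T x - ?T (- x)) / (2 * \<i>)"
    unfolding sin_eq sum_subtractf[symmetric] sum_divide_distrib
    by (simp add: algebra_simps)
  then have "norm ?S = norm (?T x - ?T (- x)) / 2"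
    by (simp add: norm_divide norm_mult)
  then have "?c * norm ?S \<le> ?c * ((norm (?T x) + norm (?T (- x))) / 2)"
    by (intro mult_left_mono) (auto intro: norm_triangle_ineq4)
  \<comment> \<open>The modulus depends only on the absolute value of the sine of half the angle, so
    the frequencies \<open>x\<close> and \<open>- x\<close> share the factor
    \<open>?c\<close>.\<close>
  moreover have "?c = norm (1 - cis x ^ r)" "?c = norm (1 - cis (- x) ^ r)"
    by (simp_all add: Complex.DeMoivre norm_one_minus_cis)
  moreover have "norm (1 - cis x ^ r) * norm (?T x) \<le> ?E"
    "norm (1 - cis (- x) ^ r) * norm (?T (- x)) \<le> ?E"
    by (rule norm_sum_shift_le[OF assms]; simp)+
  ultimately show ?thesis
    by (simp add: algebra_simps add_divide_distrib)
qed

section \<open>Tail variation of the coefficients\<close>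

text \<open>The dyadic block starting at 2^i m contributes at most \<eta> / (2^i m), and the
  geometric series sums to at most 2 \<eta> / m.\<close>

lemma sum_dyadic_le:
  fixes f :: "nat \<Rightarrow> real"
  assumes f: "\<And>n. 0 \<le> f n"
    and dyadic: "\<And>m. m \<ge> N \<Longrightarrow> real m * (\<Sum>n=m..2*m-1. f n) \<le> \<eta>"
    and "1 \<le> N" "N \<le> m"
  shows "real m * (\<Sum>n\<in>{m..<M}. f n) \<le> 2 * \<eta>"
proof -
  have pow: "real m * (\<Sum>n\<in>{m..<2^j*m}. f n) \<le> 2 * \<eta>" if "N \<le> m" for j m
    using that
  proof (induction j arbitrary: m)
    case 0
    have "0 \<le> real m * (\<Sum>n=m..2*m-1. f n)"
      by (intro mult_nonneg_nonneg sum_nonneg f) auto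
    with dyadic[OF 0] show ?case by simp
  next
    case (Suc j)
    have "{m..2*m-1} = {m..<2*m}"
      using Suc.prems \<open>1 \<le> N\<close> by auto
    with dyadic[OF Suc.prems] have "real m * (\<Sum>n\<in>{m..<2*m}. f n) \<le> \<eta>" by simp
    \<comment> \<open>The induction hypothesis at \<open>2*m\<close> carries twice the needed
      weight, so everything after the first block costs only one further \<eta>.\<close>
    moreover have "2 * (real m * (\<Sum>n\<in>{2*m..<2^j*(2*m)}. f n)) \<le> 2 * \<eta>"
      using Suc.IH[of "2*m"] Suc.prems by (simp add: algebra_simps)
    moreover have "(\<Sum>n\<in>{m..<2^Suc j*m}. f n)
        = (\<Sum>n\<in>{m..<2*m}. f n) + (\<Sum>n\<in>{2*m..<2^j*(2*m)}. f n)"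
      by (subst sum.atLeastLessThan_concat) (auto simp: algebra_simps)
    ultimately show ?case by (simp add: distrib_left)
  qed
  have "M \<le> 2 ^ M * 1" by (simp add: less_imp_le)
  also have "\<dots> \<le> 2 ^ M * m" using assms by (intro mult_left_mono) auto
  finally have "(\<Sum>n\<in>{m..<M}. f n) \<le> (\<Sum>n\<in>{m..<2^M*m}. f n)"
    by (intro sum_mono2 f) auto
  then show ?thesis
    using pow[OF assms(4), of M] mult_left_mono[of _ _ "real m"] by (meson of_nat_0_le_iff order_trans)
qed

lemma beta_star_nonneg: "0 \<le> beta_star r c a m"
  unfolding beta_star_def by (intro add_nonneg_nonneg sum_nonneg) auto

text \<open>Every index in the second sum is at least m/(2c) and hence at least \<open>N\<close>. So
  |a_k|/k = k|a_k|/k^2 is at most \<delta> (2c/m)^2; there are at most cm such terms, and the weight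
  m turns the total into 4 c^3 \<delta>.\<close>

lemma mult_beta_star_le:
  assumes c: "c > 1" and "\<delta> \<ge> 0" and small: "\<And>k. k \<ge> N \<Longrightarrow> real k * norm (a k) \<le> \<delta>"
    and m: "real m \<ge> 2 * c * (real N + 1)"
  shows "real m * beta_star r c a m \<le> (real r + 4 * c ^ 3) * \<delta>"
proof -
  have mN: "real N + 1 \<le> real m / (2 * c)" using m c by (simp add: field_simps)
  also have "\<dots> \<le> real m"
    using c mult_right_mono[of 1 "2 * c" "real m"] by (simp add: divide_le_eq mult.commute)
  finally have "N \<le> m" "m > 0" by auto
  have "real m * norm (a k) \<le> \<delta>" if "k \<ge> m" for k
    using small[of k] that \<open>N \<le> m\<close> mult_right_mono[of "real m" "real k" "norm (a k)"]
    by auto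
  then have "real m * (\<Sum>k = m..m + r - 1. norm (a k)) \<le> real (card {m..m + r - 1}) * \<delta>"
    unfolding sum_distrib_left by (intro sum_bounded_above) auto
  moreover have "card {m..m + r - 1} = r" using \<open>m > 0\<close> by simp
  ultimately have 1: "real m * (\<Sum>k = m..m + r - 1. norm (a k)) \<le> real r * \<delta>" by simp
  define L where "L = max 1 (nat \<lfloor>real m / c\<rfloor>)"
  define U where "U = nat \<lfloor>c * real m\<rfloor>"
  have "norm (a k) / real k \<le> \<delta> * (2 * c / real m)\<^sup>2" if "k \<ge> L" for k
  proof -
    have "k \<ge> 1" "real k \<ge> of_int \<lfloor>real m / c\<rfloor>" using that unfolding L_def by linarith+
    \<comment> \<open>The 1 lost to the floor is absorbed because m/(2c) is at least N + 1.\<close>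
    then have "real k \<ge> real m / c - 1" by linarith
    then have k: "real k \<ge> real m / (2 * c)" "k \<ge> N"
      using mN by (auto simp: field_simps)
    have "norm (a k) / real k = (real k * norm (a k)) / (real k)\<^sup>2"
      using \<open>k \<ge> 1\<close> by (simp add: power2_eq_square)
    also have "\<dots> \<le> \<delta> / (real m / (2 * c))\<^sup>2"
      using k small[of k] \<open>\<delta> \<ge> 0\<close> \<open>m > 0\<close> c by (intro frac_le power_mono) auto
    finally show ?thesis by (simp add: power_divide)
  qed
  then have "(\<Sum>k = L..U. norm (a k) / real k) \<le> real (card {L..U}) * (\<delta> * (2 * c / real m)\<^sup>2)"
    by (intro sum_bounded_above) auto
  also have "\<dots> \<le> (c * real m) * (\<delta> * (2 * c / real m)\<^sup>2)"
  proof (rule mult_right_mono)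
    have "card {L..U} \<le> U" unfolding L_def by simp
    then show "real (card {L..U}) \<le> c * real m"
      unfolding U_def using c of_nat_floor[of "c * real m"] by (simp add: order_trans[OF of_nat_mono])
  qed (use \<open>\<delta> \<ge> 0\<close> in auto)
  finally have "real m * (\<Sum>k = L..U. norm (a k) / real k)
      \<le> real m * ((c * real m) * (\<delta> * (2 * c / real m)\<^sup>2))"
    by (intro mult_left_mono) auto
  also have "\<dots> = 4 * c ^ 3 * \<delta>"
    using \<open>m > 0\<close> by (simp add: field_simps power2_eq_square power3_eq_cube)
  finally have "real m * (\<Sum>k = L..U. norm (a k) / real k) \<le> 4 * c ^ 3 * \<delta>" .
  with 1 show ?thesis
    unfolding beta_star_def L_def U_def by (simp add: algebra_simps)
qed

lemma GM_beta_star_variation: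
  assumes "b \<in> GM_beta_star r" and lim: "(\<lambda>n. real n * norm (b n)) \<longlonglongrightarrow> 0" and "e > 0"
  shows "\<exists>N\<ge>1. \<forall>m\<ge>N. \<forall>M. real m * (\<Sum>n\<in>{m<..M}. norm (b n - b (n + r))) \<le> e"
proof -
  from assms(1) obtain c K where c: "c > 1"
    and K: "\<And>m. m \<ge> 1 \<Longrightarrow> (\<Sum>n = m..2 * m - 1. norm (b n - b (n + r))) \<le> K * beta_star r c b m"
    unfolding GM_beta_star_def by blast
  \<comment> \<open>The sign of \<open>K\<close> is unknown, so |K| + 1 replaces it and keeps
    \<open>C\<close> positive; the leading 2 pays for the dyadic summation.\<close>
  define C where "C = 2 * (\<bar>K\<bar> + 1) * (real r + 4 * c ^ 3)"
  have "C > 0" unfolding C_def using c by (intro mult_pos_pos add_nonneg_pos) auto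
  define \<delta> where "\<delta> = e / C"
  have "\<delta> > 0" unfolding \<delta>_def using \<open>e > 0\<close> \<open>C > 0\<close> by simp
  obtain N0 where N0: "\<And>k. k \<ge> N0 \<Longrightarrow> real k * norm (b k) \<le> \<delta>"
    using LIMSEQ_D[OF lim \<open>\<delta> > 0\<close>] by (auto simp: less_imp_le abs_mult intro: less_imp_le)
  define N where "N = max 1 (nat \<lceil>2 * c * (real N0 + 1)\<rceil>)"
  have dyadic: "real m * (\<Sum>n = m..2*m-1. norm (b n - b (n + r))) \<le> e / 2" if "m \<ge> N" for m
  proof -
    have m: "m \<ge> 1" "real m \<ge> 2 * c * (real N0 + 1)"
      using that unfolding N_def by linarith+
    have "K * beta_star r c b m \<le> (\<bar>K\<bar> + 1) * beta_star r c b m"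
      by (intro mult_right_mono beta_star_nonneg) auto
    with K[OF m(1)] have "(\<Sum>n = m..2*m-1. norm (b n - b (n + r))) \<le> (\<bar>K\<bar> + 1) * beta_star r c b m"
      by linarith
    then have "real m * (\<Sum>n = m..2*m-1. norm (b n - b (n + r)))
        \<le> real m * ((\<bar>K\<bar> + 1) * beta_star r c b m)"
      by (intro mult_left_mono) auto
    also have "\<dots> = (\<bar>K\<bar> + 1) * (real m * beta_star r c b m)" by simp
    also have "\<dots> \<le> (\<bar>K\<bar> + 1) * ((real r + 4 * c ^ 3) * \<delta>)"
      using \<open>\<delta> > 0\<close> by (intro mult_left_mono mult_beta_star_le[OF c _ N0 m(2)]) auto
    also have "\<dots> = C * \<delta> / 2" unfolding C_def by simp
    also have "\<dots> = e / 2" unfolding \<delta>_def using \<open>C > 0\<close> by simp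
    finally show ?thesis .
  qed
  show ?thesis
  proof (intro exI[of _ N] conjI allI impI)
    show "N \<ge> 1" by (simp add: N_def)
    fix m M assume "m \<ge> N"
    have "(\<Sum>n\<in>{m<..M}. norm (b n - b (n + r))) \<le> (\<Sum>n\<in>{m..<Suc M}. norm (b n - b (n + r)))"
      by (intro sum_mono2) auto
    then have "real m * (\<Sum>n\<in>{m<..M}. norm (b n - b (n + r)))
        \<le> real m * (\<Sum>n\<in>{m..<Suc M}. norm (b n - b (n + r)))"
      by (intro mult_left_mono) auto
    also have "\<dots> \<le> 2 * (e / 2)"
      by (rule sum_dyadic_le[OF _ dyadic \<open>N \<ge> 1\<close> \<open>m \<ge> N\<close>]) auto
    finally show "real m * (\<Sum>n\<in>{m<..M}. norm (b n - b (n + r))) \<le> e" by simp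
  qed
qed

section \<open>Sine sums at the grid points\<close>

lemma sum_reflect:
  fixes f :: "nat \<Rightarrow> 'a :: comm_monoid_add"
  shows "(\<Sum>k\<in>{1..<r}. f (r - k)) = (\<Sum>k\<in>{1..<r}. f k)"
  by (rule sum.reindex_bij_witness[of _ "\<lambda>k. r - k" "\<lambda>k. r - k"]) auto

text \<open>Adding the sum to its reflection under k -> r - k doubles it and replaces the
  coefficients by \<open>c k - c (r - k)\<close>. Their norms are invariant under the reflection, so
  folding the upper half onto the lower one gives the factor 2 back.\<close>

lemma norm_sum_antisymmetric_le:
  fixes c :: "nat \<Rightarrow> complex" and s :: "nat \<Rightarrow> real"
  assumes anti: "\<And>k. k \<in> {1..<r} \<Longrightarrow> s (r - k) = - s k" and bound: "\<And>k. \<bar>s k\<bar> \<le> 1"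
  shows "norm (\<Sum>k\<in>{1..<r}. c k * of_real (s k)) \<le> (\<Sum>k=1..r div 2. norm (c k - c (r - k)))"
proof -
  let ?D = "\<lambda>k. norm (c k - c (r - k))"
  let ?S = "\<Sum>k\<in>{1..<r}. c k * of_real (s k)"
  have "?S = (\<Sum>k\<in>{1..<r}. c (r - k) * of_real (s (r - k)))"
    by (rule sum_reflect[symmetric])
  also have "\<dots> = - (\<Sum>k\<in>{1..<r}. c (r - k) * of_real (s k))"
    unfolding sum_negf[symmetric] by (intro sum.cong) (auto simp: anti)
  finally have "2 * ?S = (\<Sum>k\<in>{1..<r}. (c k - c (r - k)) * of_real (s k))"
    by (simp add: sum_subtractf algebra_simps)
  then have "2 * norm ?S = norm (\<Sum>k\<in>{1..<r}. (c k - c (r - k)) * of_real (s k))"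
    by (metis norm_mult norm_numeral)
  also have "\<dots> \<le> (\<Sum>k\<in>{1..<r}. ?D k)"
    by (rule sum_norm_le) (use bound in \<open>auto simp: norm_mult intro!: mult_left_le\<close>)
  also have "\<dots> \<le> (\<Sum>k\<in>{1..r div 2} \<union> {r div 2<..<r}. ?D k)"
    by (intro sum_mono2) auto
  also have "\<dots> \<le> (\<Sum>k\<in>{1..r div 2}. ?D k) + (\<Sum>k\<in>{r div 2<..<r}. ?D k)"
    by (subst sum.union_disjoint) auto
  also have "(\<Sum>k\<in>{r div 2<..<r}. ?D k) = (\<Sum>k\<in>{0<..<r - r div 2}. ?D k)"
    by (rule sum.reindex_bij_witness[of _ "\<lambda>k. r - k" "\<lambda>k. r - k"])
      (auto simp: norm_minus_commute)
  \<comment> \<open>The folded range is the same for odd \<open>r\<close>; for even \<open>r\<close>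
    it lacks only the fixed point r/2.\<close>
  also have "\<dots> \<le> (\<Sum>k\<in>{1..r div 2}. ?D k)"
    by (intro sum_mono2) auto
  finally show ?thesis by simp
qed

lemma sin_period_grid:
  assumes "real r * x = 2 * pi * of_int l"
  shows "sin (real (r * q + k) * x) = sin (real k * x)"
    and "k \<le> r \<Longrightarrow> sin (real (r - k) * x) = - sin (real k * x)"
proof -
  have "real (r * q + k) * x = real k * x + real q * (real r * x)"
    by (simp add: algebra_simps)
  also have "\<dots> = real k * x + 2 * pi * of_int (int q * l)"
    unfolding assms by simp
  finally show "sin (real (r * q + k) * x) = sin (real k * x)"
    by (simp only: sin_add cos_int_2pin sin_int_2pin mult_1_right mult_zero_right add_0_right)
  assume "k \<le> r"
  then have "real (r - k) * x = 2 * pi * of_int l - real k * x"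
    unfolding assms[symmetric] by (simp add: algebra_simps)
  then show "sin (real (r - k) * x) = - sin (real k * x)"
    by (simp only: sin_diff cos_int_2pin sin_int_2pin mult_1_left mult_zero_left diff_0)
qed

text \<open>On the grid a full block of \<open>r\<close> terms is bounded by the summable
  \<open>d q\<close> independently of \<open>x\<close>, so the Weierstrass test handles whole
  blocks. An incomplete last block is at most \<open>t q\<close>, which vanishes in the limit with
  \<open>b\<close>.\<close>

lemma uniformly_Cauchy_sin_sum_grid:
  fixes b :: "nat \<Rightarrow> complex"
  assumes "r \<ge> 1" "b \<longlonglongrightarrow> 0"
    and sm: "summable (\<lambda>n. \<Sum>k = 1..r div 2. norm (b (r * Suc n + k) - b (r * Suc n + r - k)))"
  shows "uniformly_Cauchy_on {x. \<exists>l::int. real r * x = 2 * pi * of_int l}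
    (\<lambda>N x. \<Sum>n = 1..N. b n * of_real (sin (real n * x)))"
proof -
  define X where "X = {x. \<exists>l::int. real r * x = 2 * pi * of_int l}"
  define d where "d q = (\<Sum>k = 1..r div 2. norm (b (r * q + k) - b (r * q + r - k)))" for q
  define S where "S N x = (\<Sum>n = 1..N. b n * of_real (sin (real n * x)))" for N x
  define B where "B q x = (\<Sum>k = 1..r. b (r * q + k) * of_real (sin (real k * x)))" for q x
  define t where "t q = (\<Sum>k = 1..r. norm (b (r * q + k)))" for q
  \<comment> \<open>The hypothesis starts at block 1; block 0 is a single extra term.\<close>
  have "summable d"
    using sm unfolding d_def[symmetric] by (simp add: summable_Suc_iff)
  have B: "norm (B q x) \<le> d q" if "x \<in> X" for q x
  proof -
    from that obtain l where l: "real r * x = 2 * pi * of_int l" unfolding X_def by auto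
    \<comment> \<open>The index \<open>k = r\<close> has no reflected partner in the block, but its
      sine vanishes.\<close>
    have "sin (real r * x) = 0" using sin_period_grid(2)[OF l, of r] by simp
    moreover have "{1..r} = insert r {1..<r}" using \<open>r \<ge> 1\<close> by auto
    ultimately have "B q x = (\<Sum>k\<in>{1..<r}. b (r * q + k) * of_real (sin (real k * x)))"
      unfolding B_def by simp
    also have "norm \<dots> \<le> (\<Sum>k = 1..r div 2. norm (b (r * q + k) - b (r * q + (r - k))))"
      by (rule norm_sum_antisymmetric_le) (auto simp: sin_period_grid(2)[OF l] simp del: of_nat_diff)
    also have "\<dots> = d q" unfolding d_def by (intro sum.cong) auto
    finally show ?thesis .
  qed
  have block: "S (r * q + j) x = S (r * q) x + (\<Sum>k = 1..j. b (r * q + k) * of_real (sin (real k * x)))"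
    if "x \<in> X" for q j x
  proof -
    from that obtain l where l: "real r * x = 2 * pi * of_int l" unfolding X_def by auto
    show ?thesis
    proof (induction j)
      case (Suc j)
      have "S (r * q + Suc j) x = S (r * q + j) x
          + b (r * q + Suc j) * of_real (sin (real (r * q + Suc j) * x))"
        by (simp add: S_def)
      then show ?case
        unfolding sin_period_grid(1)[OF l] by (simp add: Suc.IH)
    qed simp
  qed
  have S_blocks: "S (r * Q) x = (\<Sum>q<Q. B q x)" if "x \<in> X" for Q x
  proof (induction Q)
    case (Suc Q)
    then show ?case using block[OF that, of Q r] by (simp add: B_def add.commute)
  qed (simp add: S_def)
  have rest: "dist (S N x) (\<Sum>q<N div r. B q x) \<le> t (N div r)" if "x \<in> X" for N x
  proof -
    have "S N x = S (r * (N div r) + N mod r) x" by simp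
    then have "dist (S N x) (\<Sum>q<N div r. B q x)
        = norm (\<Sum>k = 1..N mod r. b (r * (N div r) + k) * of_real (sin (real k * x)))"
      unfolding block[OF that] S_blocks[OF that] by (simp add: dist_norm)
    also have "\<dots> \<le> (\<Sum>k = 1..N mod r. norm (b (r * (N div r) + k)))"
      by (rule sum_norm_le) (auto simp: norm_mult intro!: mult_left_le)
    also have "\<dots> \<le> t (N div r)"
      unfolding t_def using \<open>r \<ge> 1\<close> by (intro sum_mono2) (auto intro: order.trans less_imp_le)
    finally show ?thesis .
  qed
  have "t \<longlonglongrightarrow> (\<Sum>k = 1..r. 0)"
    unfolding t_def
  proof (intro tendsto_sum tendsto_norm_zero)
    fix k
    have "filterlim (\<lambda>q. r * q + k) sequentially sequentially"
      using \<open>r \<ge> 1\<close> by (intro filterlim_subseq) (auto simp: strict_mono_def)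
    then show "(\<lambda>q. b (r * q + k)) \<longlonglongrightarrow> 0"
      by (rule filterlim_compose[OF \<open>b \<longlonglongrightarrow> 0\<close>])
  qed
  then have "t \<longlonglongrightarrow> 0" by simp
  have Cau: "uniformly_Cauchy_on X (\<lambda>Q x. \<Sum>q<Q. B q x)"
    by (intro uniformly_convergent_Cauchy Weierstrass_m_test'[OF B \<open>summable d\<close>])
  have "uniformly_Cauchy_on X S"
    unfolding uniformly_Cauchy_on_def
  proof (intro allI impI)
    fix e :: real assume "e > 0"
    then obtain Q1 where Q1: "\<And>x m n. x \<in> X \<Longrightarrow> m \<ge> Q1 \<Longrightarrow> n \<ge> Q1
        \<Longrightarrow> dist (\<Sum>q<m. B q x) (\<Sum>q<n. B q x) < e / 3"
      using Cau unfolding uniformly_Cauchy_on_def by (meson divide_pos_pos zero_less_numeral)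
    obtain Q2 where Q2: "\<And>q. q \<ge> Q2 \<Longrightarrow> t q < e / 3"
      using LIMSEQ_D[OF \<open>t \<longlonglongrightarrow> 0\<close>, of "e / 3"] \<open>e > 0\<close> by fastforce
    \<comment> \<open>The factor \<open>r\<close> ensures that the number of complete blocks reaches
      both thresholds; two incomplete blocks and one difference of block sums cost e/3 each.\<close>
    have "dist (S m x) (S n x) < e" if "x \<in> X" "m \<ge> r * max Q1 Q2" "n \<ge> r * max Q1 Q2" for x m n
    proof -
      have "m div r \<ge> max Q1 Q2" "n div r \<ge> max Q1 Q2"
        using div_le_mono[OF that(2), of r] div_le_mono[OF that(3), of r] \<open>r \<ge> 1\<close> by simp_all
      then have "dist (\<Sum>q<m div r. B q x) (\<Sum>q<n div r. B q x) < e / 3"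
        "t (m div r) < e / 3" "t (n div r) < e / 3"
        using Q1[OF that(1)] Q2 by auto
      with rest[OF that(1), of m] rest[OF that(1), of n] show ?thesis
        by metric
    qed
    then show "\<exists>M. \<forall>x\<in>X. \<forall>m\<ge>M. \<forall>n\<ge>M. dist (S m x) (S n x) < e"
      by blast
  qed
  then show ?thesis unfolding X_def S_def[abs_def] .
qed

section \<open>Uniform Cauchy estimate\<close>

lemma norm_sum_block_le:
  fixes b :: "nat \<Rightarrow> 'a :: real_normed_vector"
  assumes "\<And>k. k \<ge> m \<Longrightarrow> real k * norm (b k) \<le> \<delta>"
  shows "real m * (\<Sum>n\<in>{m<..m+r}. norm (b n)) \<le> real r * \<delta>"
proof -
  have "real m * norm (b n) \<le> \<delta>" if "n \<in> {m<..m+r}" for n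
    using assms[of n] that mult_right_mono[of "real m" "real n" "norm (b n)"] by auto
  then have "(\<Sum>n\<in>{m<..m+r}. real m * norm (b n)) \<le> real (card {m<..m+r}) * \<delta>"
    by (intro sum_bounded_above) auto
  then show ?thesis by (simp add: sum_distrib_left)
qed

theorem theorem6:
  fixes r :: nat and b :: "nat \<Rightarrow> complex"
  assumes "r \<ge> 3"
    and "b \<in> GM_beta_star r"
    and "(\<lambda>n. real n * norm (b n)) \<longlonglongrightarrow> 0"
    and "summable (\<lambda>n. \<Sum>k = 1..r div 2. norm (b (r * Suc n + k) - b (r * Suc n + r - k)))"
  shows "uniformly_convergent_on (UNIV :: real set)
           (\<lambda>N x. \<Sum>n = 1..N. b n * complex_of_real (sin (real n * x)))"
proof (intro Cauchy_uniformly_convergent uniformly_Cauchy_onI')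
  fix e :: real assume "e > 0"
  define S where "S N M x = (\<Sum>n\<in>{N<..M}. b n * complex_of_real (sin (real n * x)))" for N M x
  have dist_S: "dist (\<Sum>n = 1..N. b n * complex_of_real (sin (real n * x)))
      (\<Sum>n = 1..M. b n * complex_of_real (sin (real n * x))) = norm (S N M x)" if "N \<le> M" for N M x
  proof -
    have "{1..M} = {1..N} \<union> {N<..M}" using that by auto
    then have "(\<Sum>n = 1..M. b n * complex_of_real (sin (real n * x)))
       = (\<Sum>n = 1..N. b n * complex_of_real (sin (real n * x))) + S N M x"
      unfolding S_def by (simp only:) (subst sum.union_disjoint; auto)
    then show ?thesis by (simp add: dist_norm)
  qed
  \<comment> \<open>The pieces below add up to (4r + 4) \<delta> = e/2.\<close>
  define \<delta> where "\<delta> = e / (8 * real r + 8)"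
  have "\<delta> > 0" unfolding \<delta>_def using \<open>e > 0\<close> by simp
  have "b \<longlonglongrightarrow> 0"
  proof (rule tendsto_norm_zero_cancel, rule tendsto_sandwich[OF _ _ tendsto_const assms(3)])
    show "\<forall>\<^sub>F n in sequentially. norm (b n) \<le> real n * norm (b n)"
      using eventually_ge_at_top[of 1]
    proof eventually_elim
      case (elim n)
      then show ?case using mult_right_mono[of 1 "real n" "norm (b n)"] by simp
    qed
  qed simp
  obtain N1 where N1: "\<And>k. k \<ge> N1 \<Longrightarrow> real k * norm (b k) \<le> \<delta>"
    using LIMSEQ_D[OF assms(3) \<open>\<delta> > 0\<close>] by (auto simp: less_imp_le abs_mult intro: less_imp_le)
  obtain N2 where "N2 \<ge> 1"
    and N2: "\<And>m M. m \<ge> N2 \<Longrightarrow> real m * (\<Sum>n\<in>{m<..M}. norm (b n - b (n + r))) \<le> \<delta>"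
    using GM_beta_star_variation[OF assms(2,3) \<open>\<delta> > 0\<close>] by blast
  have "uniformly_Cauchy_on {x. \<exists>l::int. real r * x = 2 * pi * of_int l}
      (\<lambda>N x. \<Sum>n = 1..N. b n * complex_of_real (sin (real n * x)))"
    using assms \<open>b \<longlonglongrightarrow> 0\<close> by (intro uniformly_Cauchy_sin_sum_grid) auto
  then obtain N3 where *: "\<forall>x\<in>{x. \<exists>l::int. real r * x = 2 * pi * of_int l}. \<forall>N\<ge>N3. \<forall>M\<ge>N3.
      dist (\<Sum>n = 1..N. b n * complex_of_real (sin (real n * x)))
        (\<Sum>n = 1..M. b n * complex_of_real (sin (real n * x))) < \<delta>"
    using \<open>\<delta> > 0\<close> unfolding uniformly_Cauchy_on_def by meson
  have N3: "norm (S N M x) \<le> \<delta>" if "real r * x = 2 * pi * of_int l" "N \<ge> N3" "M \<ge> N" for N M x l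
    unfolding dist_S[OF that(3), symmetric]
    by (rule less_imp_le, rule *[rule_format]) (use that in auto)
  define N0 where "N0 = max N1 (max N2 N3)"
  have "norm (S N M x) < e" if "N \<ge> N0" "M > N" for x N M
  proof -
    have N: "N \<ge> N1" "N \<ge> N2" "N \<ge> N3" "N \<ge> 1" using that \<open>N2 \<ge> 1\<close> unfolding N0_def by auto
    \<comment> \<open>Rounding picks the nearest grid point, which makes |rh| at most pi, as
      \<open>norm_one_minus_cis_ge\<close> requires.\<close>
    define l where "l = round (real r * x / (2 * pi))"
    define y where "y = 2 * pi * of_int l / real r"
    define h where "h = x - y"
    have y: "real r * y = 2 * pi * of_int l" unfolding y_def using \<open>r \<ge> 3\<close> by simp
    have "\<bar>of_int l - real r * x / (2 * pi)\<bar> * (2 * pi) \<le> 1 / 2 * (2 * pi)"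
      unfolding l_def by (intro mult_right_mono of_int_round_abs_le) auto
    then have "\<bar>(of_int l - real r * x / (2 * pi)) * (2 * pi)\<bar> \<le> pi"
      by (simp add: abs_mult)
    moreover have "(of_int l - real r * x / (2 * pi)) * (2 * pi) = - (real r * h)"
      unfolding h_def right_diff_distrib y by (simp add: field_simps)
    ultimately have rh: "\<bar>real r * h\<bar> \<le> pi" by simp
    show ?thesis
    proof (cases "h = 0")
      case True
      then have "norm (S N M x) \<le> \<delta>" using N3[OF y N(3), of M] that unfolding h_def by simp
      also have "\<delta> < e" unfolding \<delta>_def using \<open>e > 0\<close> by (simp add: field_simps add_pos_nonneg)
      finally show ?thesis .
    next
      case False
      define p where "p = nat \<lfloor>1 / \<bar>h\<bar>\<rfloor>"
      have p: "real p \<le> 1 / \<bar>h\<bar>" "1 / \<bar>h\<bar> < real p + 1"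
        unfolding p_def using False by (auto simp: floor_less_iff)
      \<comment> \<open>Clamping \<open>p\<close> to [N, M] may empty either part. A nonempty first
        part forces \<open>P \<le> p\<close>, a nonempty second part forces
        \<open>p \<le> P\<close>.\<close>
      define P where "P = max N (min M p)"
      have P: "N \<le> P" "P \<le> M" using that unfolding P_def by auto
      have "S N M x = S N P x + S P M x"
      proof -
        have "{N<..M} = {N<..P} \<union> {P<..M}" using P by auto
        then show ?thesis
          unfolding S_def by (simp only:) (subst sum.union_disjoint; auto)
      qed
      \<comment> \<open>One \<delta> is the grid sum at \<open>y\<close>; the other is the cost of
        moving from \<open>x\<close> to \<open>y\<close>, at most \<open>P\<close> terms of size
        \<delta> |h| with P|h| at most 1.\<close>
      moreover have "norm (S N P x) \<le> 2 * \<delta>"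
      proof (cases "P = N")
        case True
        then show ?thesis using \<open>\<delta> > 0\<close> by (simp add: S_def)
      next
        case False
        then have "P \<le> p" using P unfolding P_def by auto
        then have "real P \<le> 1 / \<bar>h\<bar>" using p(1) by linarith
        then have "real P * \<bar>h\<bar> \<le> 1" using \<open>h \<noteq> 0\<close> by (simp add: field_simps)
        have "norm (S N P x - S N P y) \<le> (\<Sum>n\<in>{N<..P}. \<delta> * \<bar>h\<bar>)"
          unfolding S_def sum_subtractf[symmetric]
        proof (rule sum_norm_le)
          fix n assume n: "n \<in> {N<..P}"
          have "norm (b n * complex_of_real (sin (real n * x)) - b n * complex_of_real (sin (real n * y)))
              = norm (b n) * \<bar>sin (real n * x) - sin (real n * y)\<bar>"
            by (metis norm_mult norm_of_real of_real_diff right_diff_distrib)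
          also have "\<dots> \<le> norm (b n) * \<bar>real n * x - real n * y\<bar>"
            by (intro mult_left_mono abs_sin_diff_le) auto
          also have "\<dots> = (real n * norm (b n)) * \<bar>h\<bar>"
            unfolding h_def by (simp add: right_diff_distrib[symmetric] abs_mult)
          also have "\<dots> \<le> \<delta> * \<bar>h\<bar>" using N1[of n] n N by (intro mult_right_mono) auto
          finally show "norm (b n * complex_of_real (sin (real n * x))
            - b n * complex_of_real (sin (real n * y))) \<le> \<delta> * \<bar>h\<bar>" .
        qed
        also have "\<dots> \<le> real P * (\<delta> * \<bar>h\<bar>)"
          using \<open>\<delta> > 0\<close> by (simp add: mult_right_mono)
        also have "\<dots> = \<delta> * (real P * \<bar>h\<bar>)" by simp
        also have "\<dots> \<le> \<delta> * 1" using \<open>\<delta> > 0\<close> \<open>real P * \<bar>h\<bar> \<le> 1\<close> by (intro mult_left_mono) auto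
        finally have "norm (S N P x - S N P y) \<le> \<delta>" by simp
        with N3[OF y N(3) P(1)] norm_triangle_sub[of "S N P x" "S N P y"] show ?thesis by linarith
      qed
      \<comment> \<open>Two boundary blocks cost r \<delta> each and the variation costs \<delta>,
        all after weighting by \<open>P\<close>; dividing by P|h|, which is at least 1/2, doubles
        the total.\<close>
      moreover have "norm (S P M x) \<le> 2 * (2 * real r + 1) * \<delta>"
      proof (cases "P = M")
        case True
        then show ?thesis using \<open>\<delta> > 0\<close> by (simp add: S_def)
      next
        case False
        then have "p \<le> P" using P unfolding P_def by auto
        moreover have "P \<ge> 1" using P N by simp
        \<comment> \<open>The 1 lost to the floor in \<open>p\<close> is absorbed by
          \<open>P \<ge> 1\<close>.\<close>
        ultimately have "1 / \<bar>h\<bar> \<le> 2 * real P" using p(2) by linarith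
        then have hP: "1 \<le> 2 * (real P * \<bar>h\<bar>)" using \<open>h \<noteq> 0\<close> by (simp add: field_simps)
        let ?E = "(\<Sum>n\<in>{P<..P+r}. norm (b n)) + (\<Sum>n\<in>{M<..M+r}. norm (b n))
          + (\<Sum>n\<in>{P<..M}. norm (b n - b (n + r)))"
        have "real P * (\<Sum>n\<in>{M<..M+r}. norm (b n)) \<le> real M * (\<Sum>n\<in>{M<..M+r}. norm (b n))"
          using P by (intro mult_right_mono sum_nonneg) auto
        moreover have "real M * (\<Sum>n\<in>{M<..M+r}. norm (b n)) \<le> real r * \<delta>"
          "real P * (\<Sum>n\<in>{P<..P+r}. norm (b n)) \<le> real r * \<delta>"
          using N P by (auto intro!: norm_sum_block_le N1)
        moreover have "real P * (\<Sum>n\<in>{P<..M}. norm (b n - b (n + r))) \<le> \<delta>"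
          using N P by (intro N2) auto
        ultimately have PE: "real P * ?E \<le> (2 * real r + 1) * \<delta>" by (simp add: algebra_simps)
        have "cis (real r * x) = cis (real r * h)"
        proof -
          have "real r * x = real r * h + 2 * pi * of_int l"
            unfolding y[symmetric] h_def by (simp add: algebra_simps)
          then show ?thesis by (simp add: complex_eq_iff sin_add cos_add)
        qed
        \<comment> \<open>The factor \<open>r\<close> makes up for the 1/2 in
          \<open>norm_one_minus_cis_ge\<close>.\<close>
        moreover have "\<bar>h\<bar> \<le> \<bar>real r * h\<bar> / 2"
          using mult_right_mono[of 2 "real r" "\<bar>h\<bar>"] \<open>r \<ge> 3\<close> by (simp add: abs_mult)
        ultimately have "\<bar>h\<bar> \<le> norm (1 - cis (real r * x))"
          using norm_one_minus_cis_ge[OF rh] by simp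
        then have "\<bar>h\<bar> * norm (S P M x) \<le> norm (1 - cis (real r * x)) * norm (S P M x)"
          by (intro mult_right_mono) auto
        also have "\<dots> \<le> ?E"
          unfolding S_def by (rule norm_sin_sum_shift_le[OF P(2)])
        finally have "2 * real P * (\<bar>h\<bar> * norm (S P M x)) \<le> 2 * real P * ?E"
          by (intro mult_left_mono) auto
        moreover have "norm (S P M x) \<le> 2 * (real P * \<bar>h\<bar>) * norm (S P M x)"
          using mult_right_mono[OF hP, of "norm (S P M x)"] by simp
        ultimately show ?thesis using PE by (simp add: algebra_simps)
      qed
      ultimately have "norm (S N M x) \<le> 2 * \<delta> + 2 * (2 * real r + 1) * \<delta>"
        using norm_triangle_ineq[of "S N P x" "S P M x"] by simp
      also have "\<dots> = (4 * real r + 4) * \<delta>" by (simp add: algebra_simps)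
      also have "\<dots> < e" unfolding \<delta>_def using \<open>e > 0\<close> by (simp add: field_simps add_pos_nonneg)
      finally show ?thesis .
    qed
  qed
  then show "\<exists>M. \<forall>x\<in>UNIV. \<forall>m\<ge>M. \<forall>n>m.
      dist (\<Sum>n = 1..m. b n * complex_of_real (sin (real n * x)))
        (\<Sum>k = 1..n. b k * complex_of_real (sin (real k * x))) < e"
    by (intro exI[of _ N0] ballI allI impI, subst dist_S) auto
qed

end
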